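(* Let $F$ be an iterated function system on a complete metric space $M$, with attractor $A$ and generated semigroup $S=S(F)$. Then: (i) The number of ends of $F$ is an upper bound for the number of nondegenerate components of $A$. (ii) In addition, $A$ may have countably many (i.e. it has at most countably many) isolated points, each corresponding to an idempotent in $S$: for each isolated point $p$ of $A$ there is $U\in S$ with $U\circ U=U$ and $U(M)=\{p\}$. (iii) Consequently, if $F$ has one end and $S$ contains no idempotent element, then $A$ is connected.
   Context: An iterated function system (IFS) $F$ is a finite nonempty set of contractions (Lipschitz maps with constant $<1$) of a nonempty complete metric space $M$ into itself. Its attractor $A$ is the unique nonempty compact subset of $M$ with $A=\bigcup_{f\in F} f(A)$. $S=S(F)$ is the subsemigroup, under composition, of the set of all self-maps of $M$ generated by $F$ (all finite nonempty compositions of elements of $F$). An element $U\in S$ is idempotent if $U\circ U=U$; the idempotents of $S$ are exactly the constant maps in $S$. The Cayley graph $\Gamma(S)$ has vertex set $S$ and, for each $(s,f)\in S\times F$, an (oriented) edge from $s$ to $s\circ f$. A walk is an infinite sequence of vertices in which consecutive vertices are joined by an oriented edge; without loss of generality, walks originate from the identity, i.e. a walk is a sequence $(f_1\circ\cdots\circ f_n)_{n\ge 1}$ with all $f_i\in F$. A walk is a ray if all its vertices are distinct. Two rays are equivalent if for every finite set $E\subseteq S$ they have subsequences that lie in a common path component of $\Gamma(S)\smallsetminus E$ (paths here ignore edge orientation). The ends of $F$ are the equivalence classes of rays. A point $p\in A$ is isolated if $\{p\}$ is open in $A$, except that, by convention, the single point of a one-point space is regarded as nonisolated. The degenerate components of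 $A$ are the isolated points (as singletons); all other connected components of $A$ are nondegenerate. Thus a nondegenerate component may be a singleton whose point is an accumulation point of $A$, and, by the convention, the only component of a one-point attractor is nondegenerate.
   Formalization: (i) leaves out the case of one-point A with finite S (no ends there). (ii) in general gives U∘U=U only on A and U(A)={p}; U∘U=U and U(M)={p} are stated if every element of S constant on A is constant on M. The claims as worded can fail otherwise. *)

theory Defs
  imports "HOL-Analysis.Analysis" "HOL-Library.Equipollence"
begin

definition contraction :: "('a::metric_space \<Rightarrow> 'a) \<Rightarrow> bool" where
  "contraction f \<longleftrightarrow> (\<exists>c<1. c-lipschitz_on UNIV f)"

text \<open>The ambient space is the whole (automatically nonempty) type; it is required to be
  complete, via the class \<open>complete_space\<close>, where the notion is used.\<close>

definition is_ifs :: "('a::metric_space \<Rightarrow> 'a) set \<Rightarrow> bool" where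
  "is_ifs F \<longleftrightarrow> finite F \<and> F \<noteq> {} \<and> (\<forall>f\<in>F. contraction f)"

text \<open>In a complete space an iterated function system has exactly one attractor.\<close>

definition is_attractor :: "('a::metric_space \<Rightarrow> 'a) set \<Rightarrow> 'a set \<Rightarrow> bool" where
  "is_attractor F A \<longleftrightarrow> compact A \<and> A \<noteq> {} \<and> A = (\<Union>f\<in>F. f ` A)"

inductive_set ifs_semigroup :: "('a \<Rightarrow> 'a) set \<Rightarrow> ('a \<Rightarrow> 'a) set" for F where
  generator: "f \<in> F \<Longrightarrow> f \<in> ifs_semigroup F"
| comp: "s \<in> ifs_semigroup F \<Longrightarrow> t \<in> ifs_semigroup F \<Longrightarrow> s \<circ> t \<in> ifs_semigroup F"

definition cayley_edges :: "('a \<Rightarrow> 'a) set \<Rightarrow> (('a \<Rightarrow> 'a) \<times> ('a \<Rightarrow> 'a)) set" where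
  "cayley_edges F = {(s, s \<circ> f) | s f. s \<in> ifs_semigroup F \<and> f \<in> F}"

text \<open>Vertices outside \<open>E\<close> joined by an unoriented path that avoids \<open>E\<close>.\<close>

definition connected_avoiding ::
    "('a \<Rightarrow> 'a) set \<Rightarrow> ('a \<Rightarrow> 'a) set \<Rightarrow> (('a \<Rightarrow> 'a) \<times> ('a \<Rightarrow> 'a)) set" where
  "connected_avoiding F E =
     (let V = ifs_semigroup F - E
      in ((cayley_edges F \<union> (cayley_edges F)\<inverse>) \<inter> V \<times> V)\<^sup>* \<inter> V \<times> V)"

definition path_components ::
    "('a \<Rightarrow> 'a) set \<Rightarrow> ('a \<Rightarrow> 'a) set \<Rightarrow> ('a \<Rightarrow> 'a) set set" where
  "path_components F E = (ifs_semigroup F - E) // connected_avoiding F E"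

text \<open>\<open>w n\<close> is a product of \<open>n + 1\<close> generators: a walk leaves the identity, which need
  not be a vertex, and is indexed from its first vertex, a generator.\<close>

definition is_walk :: "('a \<Rightarrow> 'a) set \<Rightarrow> (nat \<Rightarrow> 'a \<Rightarrow> 'a) \<Rightarrow> bool" where
  "is_walk F w \<longleftrightarrow> (\<exists>g. (\<forall>n. g n \<in> F) \<and> w 0 = g 0 \<and> (\<forall>n. w (Suc n) = w n \<circ> g (Suc n)))"

definition rays :: "('a \<Rightarrow> 'a) set \<Rightarrow> (nat \<Rightarrow> 'a \<Rightarrow> 'a) set" where
  "rays F = {w. is_walk F w \<and> inj w}"

definition ray_equiv ::
    "('a \<Rightarrow> 'a) set \<Rightarrow> ((nat \<Rightarrow> 'a \<Rightarrow> 'a) \<times> (nat \<Rightarrow> 'a \<Rightarrow> 'a)) set" where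
  "ray_equiv F = {(v, w). v \<in> rays F \<and> w \<in> rays F \<and>
     (\<forall>E. finite E \<and> E \<subseteq> ifs_semigroup F \<longrightarrow>
       (\<exists>\<phi> \<psi>. strict_mono (\<phi> :: nat \<Rightarrow> nat) \<and> strict_mono (\<psi> :: nat \<Rightarrow> nat) \<and>
         (\<exists>C\<in>path_components F E. range (v \<circ> \<phi>) \<union> range (w \<circ> \<psi>) \<subseteq> C)))}"

definition ends :: "('a \<Rightarrow> 'a) set \<Rightarrow> (nat \<Rightarrow> 'a \<Rightarrow> 'a) set set" where
  "ends F = rays F // ray_equiv F"

definition idempotent :: "('a \<Rightarrow> 'a) \<Rightarrow> bool" where
  "idempotent U \<longleftrightarrow> U \<circ> U = U"

text \<open>By convention the point of a one-point space is not isolated.\<close>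

definition isolated_points :: "'a::topological_space set \<Rightarrow> 'a set" where
  "isolated_points A = {p. p isolated_in A \<and> A \<noteq> {p}}"

definition nondegenerate_components :: "'a::topological_space set \<Rightarrow> 'a set set" where
  "nondegenerate_components A = components A - (\<lambda>p. {p}) ` isolated_points A"


text \<open>Two boundary cases. First, if the attractor is a single point and the semigroup is
  finite, there are no rays, hence no ends, yet one nondegenerate component.\<close>

lemma no_ends_if_finite:
  assumes "finite (ifs_semigroup F)"
  shows "ends F = {}"
proof -
  have "\<not> inj w" if w: "is_walk F w" for w
  proof
    assume "inj w"
    obtain g where g: "\<And>n. g n \<in> F" "w 0 = g 0" "\<And>n. w (Suc n) = w n \<circ> g (Suc n)"
      using w unfolding is_walk_def by blast
    have "w n \<in> ifs_semigroup F" for n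
    proof (induction n)
      case 0
      show ?case
        unfolding g(2) by (rule ifs_semigroup.generator[OF g(1)])
    next
      case (Suc n)
      show ?case
        unfolding g(3) by (rule ifs_semigroup.comp[OF Suc ifs_semigroup.generator[OF g(1)]])
    qed
    then have "finite (range w)"
      using assms by (meson finite_subset image_subsetI)
    with \<open>inj w\<close> show False
      using finite_imageD infinite_UNIV_nat by blast
  qed
  then show ?thesis
    by (auto simp: ends_def rays_def)
qed

lemma nondegenerate_components_singleton: "nondegenerate_components {p} = {{p}}"
proof -
  have "components {p} = {{p}}"
    by (simp add: components_eq_sing_iff)
  moreover have "isolated_points {p} = {}"
    by (auto simp: isolated_points_def isolated_in_def)
  ultimately show ?thesis
    by (simp add: nondegenerate_components_def)
qed

lemma constant_ifs_example:
  fixes p :: "'a::complete_space"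
  defines "F \<equiv> {\<lambda>_. p}"
  shows "is_ifs F" "is_attractor F {p}" "finite (ifs_semigroup F)"
    "\<not> nondegenerate_components {p} \<lesssim> ends F"
proof -
  show "is_ifs F"
    unfolding is_ifs_def contraction_def F_def
    using lipschitz_on_constant[of UNIV p] by (auto intro!: exI[of _ 0])
  show "is_attractor F {p}"
    by (auto simp: is_attractor_def F_def)
  have "s = (\<lambda>_. p)" if "s \<in> ifs_semigroup F" for s
    using that by induction (auto simp: F_def)
  then have "ifs_semigroup F \<subseteq> {\<lambda>_. p}"
    by blast
  then show fin: "finite (ifs_semigroup F)"
    by (rule finite_subset) simp
  show "\<not> nondegenerate_components {p} \<lesssim> ends F"
    by (simp add: no_ends_if_finite[OF fin] nondegenerate_components_singleton)
qed

text \<open>Second, an element of the semigroup that is constant on the attractor need not be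
  constant on the ambient space: here the attractor consists of two isolated points, but
  the semigroup has no constant element, hence no idempotent.\<close>

lemma isolated_without_idempotent_example:
  fixes f g :: "real \<Rightarrow> real"
  defines "f \<equiv> \<lambda>x. infdist x {0, 1} / 2" and "g \<equiv> \<lambda>x. 1 + infdist x {0, 1} / 2"
  shows "is_ifs {f, g}" "is_attractor {f, g} {0, 1}" "isolated_points {0, 1 :: real} = {0, 1}"
    "\<not> (\<exists>U\<in>ifs_semigroup {f, g}. idempotent U)"
proof -
  have lip: "(1/2)-lipschitz_on UNIV f" "(1/2)-lipschitz_on UNIV g"
    using infdist_triangle_abs[of _ "{0, 1 :: real}"]
    by (auto intro!: lipschitz_onI simp: f_def g_def dist_real_def simp flip: diff_divide_distrib)
  then show "is_ifs {f, g}"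
    unfolding is_ifs_def contraction_def by (auto intro!: exI[of _ "1/2"])
  have vals: "f 0 = 0" "f 1 = 0" "g 0 = 1" "g 1 = 1"
    by (auto simp: f_def g_def)
  then show "is_attractor {f, g} {0, 1}"
    by (auto simp: is_attractor_def)
  show "isolated_points {0, 1 :: real} = {0, 1}"
    by (auto simp: isolated_points_def isolated_in_islimpt_iff islimpt_finite)
  have dist01: "infdist x {0, 1} = min \<bar>x\<bar> \<bar>x - 1\<bar>" for x :: real
    by (simp add: infdist_def dist_real_def cInf_eq_Min)
  have affine: "\<exists>a k. a \<in> {0, 1} \<and> 0 < k \<and> k \<le> 1/2 \<and>
      (\<forall>x\<in>{0..1/2}. s x = a + k * x \<and> s (1 + x) = a + k * x)"
    if "s \<in> ifs_semigroup {f, g}" for s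
    using that
  proof induction
    case (generator h)
    then have "h = f \<or> h = g" by simp
    then show ?case
    proof
      assume "h = f"
      then show ?thesis
        by (intro exI[of _ 0] exI[of _ "1/2"]) (auto simp: f_def dist01)
    next
      assume "h = g"
      then show ?thesis
        by (intro exI[of _ 1] exI[of _ "1/2"]) (auto simp: g_def dist01)
    qed
  next
    case (comp s t)
    obtain a k where s: "a \<in> {0, 1}" "0 < k" "k \<le> 1/2"
      "\<And>x. x \<in> {0..1/2} \<Longrightarrow> s x = a + k * x \<and> s (1 + x) = a + k * x"
      using comp.IH(1) by blast
    obtain b l where t: "b \<in> {0, 1}" "0 < l" "l \<le> 1/2"
      "\<And>x. x \<in> {0..1/2} \<Longrightarrow> t x = b + l * x \<and> t (1 + x) = b + l * x"
      using comp.IH(2) by blast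
    have st: "s (b + l * x) = a + (k * l) * x" if "x \<in> {0..1/2}" for x
    proof -
      have "l * x \<le> (1/2) * (1/2)"
        using that t(2,3) by (intro mult_mono) auto
      then have "l * x \<in> {0..1/2}"
        using that t(2) by auto
      from s(4)[OF this] show ?thesis
        using t(1) by (auto simp: mult.assoc)
    qed
    have "0 < k * l" "k * l \<le> 1/2"
      using s(2,3) t(2,3) mult_mono[of k "1/2" l 1] by simp_all
    then show ?case
      using s(1) t(4) st by (intro exI[of _ a] exI[of _ "k * l"]) auto
  qed
  show "\<not> (\<exists>U\<in>ifs_semigroup {f, g}. idempotent U)"
  proof
    assume "\<exists>U\<in>ifs_semigroup {f, g}. idempotent U"
    then obtain U where U: "U \<in> ifs_semigroup {f, g}" "\<And>x. U (U x) = U x"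
      unfolding idempotent_def by (metis comp_apply)
    obtain a k where a: "a \<in> {0, 1}" "0 < k" "k \<le> 1/2"
      "\<And>x. x \<in> {0..1/2} \<Longrightarrow> U x = a + k * x \<and> U (1 + x) = a + k * x"
      using affine[OF U(1)] by blast
    have kk: "k * (1/2) \<in> {0..1/2}"
      using a by auto
    have "U (U (1/2)) = a + k * (k * (1/2))"
      using a(1) a(4)[of "1/2"] a(4)[OF kk] by auto
    moreover have "U (U (1/2)) = a + k * (1/2)"
      using U(2)[of "1/2"] a(4)[of "1/2"] by auto
    ultimately show False
      using a(2,3) by simp
  qed
qed

end

theory Submission
  imports Defs
begin

text \<open>Along a walk the images \<open>w n ` A\<close> form a decreasing sequence of compact sets whose diameters
  tend to \<open>0\<close>, so a point lying in all of them is the limit of the walk. Equivalent rays cannot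
  converge to points separated by a clopen subset of \<open>A\<close>. Conversely, a walk visits a vertex
  infinitely often only if that vertex is a constant map; a limit point \<open>p\<close> of \<open>A\<close> is a limit
  point of some \<open>f ` A\<close>, which gives a walk of non-constant maps towards \<open>p\<close>, and erasing its loops
  yields a ray. If there are no idempotents, no vertex is constant, so every point of \<open>A\<close> is the
  limit of a ray.\<close>

section \<open>Components and separation in compact metric spaces\<close>

text \<open>In a compact Hausdorff space components and quasi-components coincide, so two points of
  \<open>A\<close> can be shown to lie in one component by testing clopen subsets only.\<close>

lemma connected_component_iff_quasi_component:
  fixes A :: "'a::metric_space set"
  assumes "compact A"
  shows "connected_component A p q \<longleftrightarrow> quasi_component_of (top_of_set A) p q"
proof -
  have "compact_space (top_of_set A)" "Hausdorff_space (top_of_set A)"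
    using assms by (auto simp: compact_space_subtopology intro!: Hausdorff_space_subtopology)
  then have "quasi_component_of (top_of_set A) p = connected_component_of (top_of_set A) p"
    by (intro quasi_eq_connected_component_of) auto
  then show ?thesis
    by (auto simp: connected_component_of_def connected_component_def connectedin_subtopology)
qed

lemma separate_compact_compact:
  fixes S T :: "'a::metric_space set"
  assumes "compact S" "compact T" "S \<inter> T = {}"
  obtains \<delta> where "\<delta> > 0" "\<And>x y. \<lbrakk>x \<in> S; y \<in> T\<rbrakk> \<Longrightarrow> \<delta> \<le> dist x y"
proof (cases "S \<times> T = {}")
  case True
  then show thesis by (intro that[of 1]) auto
next
  case False
  have "continuous_on (S \<times> T) (\<lambda>z. dist (fst z) (snd z))"
    by (intro continuous_intros)
  from continuous_attains_inf[OF compact_Times[OF assms(1,2)] False this]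
  obtain a b where ab: "a \<in> S" "b \<in> T" "\<And>x y. \<lbrakk>x \<in> S; y \<in> T\<rbrakk> \<Longrightarrow> dist a b \<le> dist x y"
    by auto
  moreover have "0 < dist a b"
    using ab assms(3) by auto
  ultimately show thesis using that by blast
qed

section \<open>Walks and words in the generators\<close>

text \<open>Eliminates the sequence of generators, so that a walk can be built and checked one edge
  at a time.\<close>

lemma is_walk_iff:
  "is_walk F w \<longleftrightarrow> w 0 \<in> F \<and> (\<forall>n. \<exists>f\<in>F. w (Suc n) = w n \<circ> f)"
proof
  assume "w 0 \<in> F \<and> (\<forall>n. \<exists>f\<in>F. w (Suc n) = w n \<circ> f)"
  then obtain h where h: "w 0 \<in> F" "\<And>n. h n \<in> F" "\<And>n. w (Suc n) = w n \<circ> h n"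
    by metis
  then show "is_walk F w"
    unfolding is_walk_def
    by (intro exI[of _ "case_nat (w 0) h"]) (auto split: nat.split)
qed (auto simp: is_walk_def)

text \<open>The index is one less than the number of factors, in step with the indexing of walks. A
  map may belong to several of these sets, since different words can have the same product.\<close>

primrec words :: "('a \<Rightarrow> 'a) set \<Rightarrow> nat \<Rightarrow> ('a \<Rightarrow> 'a) set" where
  "words F 0 = F"
| "words F (Suc n) = (\<lambda>(s, f). s \<circ> f) ` (words F n \<times> F)"

text \<open>The index shift comes from counting factors: (m + 1) + (n + 1) = (m + n + 1) +
  1.\<close>

lemma words_comp: "s \<in> words F m \<Longrightarrow> t \<in> words F n \<Longrightarrow> s \<circ> t \<in> words F (Suc (m + n))"
proof (induction n arbitrary: t)
  case (Suc n)
  then obtain u f where "t = u \<circ> f" "u \<in> words F n" "f \<in> F" by auto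
  moreover from this have "s \<circ> u \<in> words F (Suc (m + n))"
    using Suc.IH Suc.prems(1) by blast
  then have "(s \<circ> u) \<circ> f \<in> words F (Suc (Suc (m + n)))"
    unfolding words.simps(2)[of F "Suc (m + n)"] using \<open>f \<in> F\<close> by blast
  ultimately show ?case by (simp only: comp_assoc add_Suc_right)
qed auto

lemma ifs_semigroup_eq: "ifs_semigroup F = (\<Union>n. words F n)"
proof
  show "ifs_semigroup F \<subseteq> (\<Union>n. words F n)"
  proof
    fix s assume "s \<in> ifs_semigroup F"
    then show "s \<in> (\<Union>n. words F n)"
    proof induction
      case (generator f)
      then have "f \<in> words F 0" by simp
      then show ?case by blast
    qed (use words_comp in blast)
  qed
  have "s \<in> ifs_semigroup F" if "s \<in> words F n" for s n
    using that by (induction n arbitrary: s)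
      (auto intro: ifs_semigroup.generator ifs_semigroup.comp)
  then show "(\<Union>n. words F n) \<subseteq> ifs_semigroup F" by blast
qed

lemma words_subset: "words F n \<subseteq> ifs_semigroup F"
  by (auto simp: ifs_semigroup_eq)

lemma finite_words: "finite F \<Longrightarrow> finite (words F n)"
  by (induction n) auto

lemma walk_in_words: "is_walk F w \<Longrightarrow> w n \<in> words F n"
proof (induction n)
  case (Suc n)
  then obtain f where "f \<in> F" "w (Suc n) = w n \<circ> f"
    unfolding is_walk_iff by blast
  with Suc show ?case by (auto simp del: comp_apply simp: image_iff)
qed (simp add: is_walk_iff)

lemma walk_in_semigroup: "is_walk F w \<Longrightarrow> w n \<in> ifs_semigroup F"
  using walk_in_words words_subset by blast

lemma walk_exists:
  assumes "\<exists>f\<in>F. P f" and step: "\<And>s. s \<in> ifs_semigroup F \<Longrightarrow> P s \<Longrightarrow> \<exists>f\<in>F. P (s \<circ> f)"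
  obtains w where "is_walk F w" "\<And>n. P (w n)"
proof -
  \<comment> \<open>The clause for \<open>n = 0\<close> makes the dependent choice start at a
    generator; membership in the semigroup is carried along because \<open>step\<close> demands
    it.\<close>
  have "\<exists>w. \<forall>n. (w n \<in> ifs_semigroup F \<and> P (w n) \<and> (n = 0 \<longrightarrow> w n \<in> F)) \<and>
      (\<exists>f\<in>F. w (Suc n) = w n \<circ> f)"
  proof (rule dependent_nat_choice)
    show "\<exists>s. s \<in> ifs_semigroup F \<and> P s \<and> ((0::nat) = 0 \<longrightarrow> s \<in> F)"
      using assms(1) ifs_semigroup.generator by blast
    fix s and n :: nat
    assume s: "s \<in> ifs_semigroup F \<and> P s \<and> (n = 0 \<longrightarrow> s \<in> F)"
    then obtain f where "f \<in> F" "P (s \<circ> f)"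
      using step by blast
    then show "\<exists>t. (t \<in> ifs_semigroup F \<and> P t \<and> (Suc n = 0 \<longrightarrow> t \<in> F)) \<and> (\<exists>f\<in>F. t = s \<circ> f)"
      using s ifs_semigroup.comp ifs_semigroup.generator by blast
  qed
  then obtain w where "is_walk F w" "\<And>n. P (w n)"
    unfolding is_walk_iff by metis
  then show thesis by (rule that)
qed

text \<open>Loop erasure: always leave a vertex from the last visit to it.\<close>

lemma walk_subsequence_ray:
  assumes w: "is_walk F w" and fin: "\<And>n. finite {m. w m = w n}"
  obtains \<tau> where "w \<circ> \<tau> \<in> rays F"
proof -
  define last where "last n = Max {m. w m = w n}" for n
  have w_last: "w (last n) = w n" for n
    using Max_in[OF fin, of n] unfolding last_def by blast
  have le_last: "m \<le> last n" if "w m = w n" for m n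
    using that fin unfolding last_def by (intro Max_ge) auto
  define \<tau> where "\<tau> = rec_nat (last 0) (\<lambda>_ t. last (Suc t))"
  have \<tau>: "\<tau> 0 = last 0" "\<tau> (Suc k) = last (Suc (\<tau> k))" for k
    by (auto simp: \<tau>_def)
  have "strict_mono \<tau>"
    unfolding strict_mono_Suc_iff using le_last \<tau>(2) Suc_le_lessD by metis
  have last_visit: "m \<le> \<tau> k" if "w m = w (\<tau> k)" for m k
    using that by (cases k) (auto simp: \<tau> w_last intro!: le_last)
  have "inj (w \<circ> \<tau>)"
  proof (rule linorder_injI)
    fix k l :: nat assume "k < l"
    then have "\<tau> k < \<tau> l"
      using \<open>strict_mono \<tau>\<close> by (simp add: strict_mono_def)
    then show "(w \<circ> \<tau>) k \<noteq> (w \<circ> \<tau>) l"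
      using last_visit[of "\<tau> l" k] by force
  qed
  \<comment> \<open>The edge taken is the one that \<open>w\<close> follows at time
    \<open>\<tau> k\<close>: its end \<open>w (Suc (\<tau> k))\<close> equals
    \<open>w (\<tau> (Suc k))\<close> by \<open>w_last\<close>.\<close>
  moreover have "is_walk F (w \<circ> \<tau>)"
    using w by (auto simp: is_walk_iff \<tau> w_last)
  ultimately show thesis
    using that by (auto simp: rays_def)
qed

section \<open>Rays and their classes\<close>

text \<open>Being injective, a ray visits the finite set \<open>E\<close> only finitely often; from
  some time \<open>N\<close> on it is itself a path avoiding \<open>E\<close>, so its tail lies in a
  single path component.\<close>

lemma ray_equiv_refl:
  assumes "w \<in> rays F"
  shows "(w, w) \<in> ray_equiv F"
proof -
  have tail: "\<exists>\<phi>::nat \<Rightarrow> nat. strict_mono \<phi> \<and> (\<exists>C\<in>path_components F E. range (w \<circ> \<phi>) \<subseteq> C)" if "finite E" for E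
  proof -
    have walk: "is_walk F w" and "inj w"
      using assms by (auto simp: rays_def)
    then have "finite (w -` E)"
      using that finite_vimageI by blast
    then obtain N where N: "\<And>n. w n \<in> E \<Longrightarrow> n < N"
      unfolding finite_nat_set_iff_bounded by blast
    define V where "V = ifs_semigroup F - E"
    define R where "R = (cayley_edges F \<union> (cayley_edges F)\<inverse>) \<inter> V \<times> V"
    have V: "w (N + n) \<in> V" for n
      using N[of "N + n"] walk_in_semigroup[OF walk] by (auto simp: V_def)
    have "(w N, w (N + n)) \<in> R\<^sup>*" for n
    proof (induction n)
      case (Suc n)
      have "(w (N + n), w (N + Suc n)) \<in> cayley_edges F"
        using walk walk_in_semigroup[OF walk] by (auto simp: cayley_edges_def is_walk_iff)
      then have "(w (N + n), w (N + Suc n)) \<in> R"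
        using V[of n] V[of "Suc n"] by (simp add: R_def)
      with Suc show ?case by simp
    qed simp
    then have "range (w \<circ> (+) N) \<subseteq> connected_avoiding F E `` {w N}"
      using V V[of 0] by (auto simp: connected_avoiding_def Let_def R_def V_def)
    moreover have "connected_avoiding F E `` {w N} \<in> path_components F E"
      using V[of 0] by (auto simp: path_components_def V_def intro: quotientI)
    moreover have "strict_mono ((+) N)"
      by (simp add: strict_mono_def)
    ultimately show ?thesis by blast
  qed
  have "\<exists>\<phi> \<psi>. strict_mono (\<phi> :: nat \<Rightarrow> nat) \<and> strict_mono (\<psi> :: nat \<Rightarrow> nat) \<and>
      (\<exists>C\<in>path_components F E. range (w \<circ> \<phi>) \<union> range (w \<circ> \<psi>) \<subseteq> C)" if "finite E" for E
    using tail[OF that] by (metis Un_absorb)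
  then show ?thesis
    using assms by (simp add: ray_equiv_def del: comp_apply)
qed

lemma ends_class_mem: "w \<in> rays F \<Longrightarrow> ray_equiv F `` {w} \<in> ends F"
  by (simp add: ends_def quotientI)

text \<open>By reflexivity \<open>w\<close> lies in its own class, hence in that of
  \<open>v\<close>.\<close>

lemma ray_equiv_if_same_class:
  "w \<in> rays F \<Longrightarrow> ray_equiv F `` {v} = ray_equiv F `` {w} \<Longrightarrow> (v, w) \<in> ray_equiv F"
  using ray_equiv_refl by blast

section \<open>Contraction along words\<close>

text \<open>One constant \<open>c\<close> serves all generators, so that the length of a word alone
  controls how much it contracts.\<close>

locale ifs_attractor =
  fixes F :: "('a::metric_space \<Rightarrow> 'a) set" and A :: "'a set" and c :: real
  assumes finite: "finite F" and c: "0 \<le> c" "c < 1"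
    and lipschitz: "\<And>f. f \<in> F \<Longrightarrow> c-lipschitz_on UNIV f"
    and compact: "compact A" and nonempty: "A \<noteq> {}" and invariant: "A = (\<Union>f\<in>F. f ` A)"
begin

lemma words_lipschitz: "s \<in> words F n \<Longrightarrow> dist (s x) (s y) \<le> c ^ Suc n * dist x y"
proof (induction n arbitrary: s x y)
  case 0
  then show ?case using lipschitz lipschitz_onD[of c UNIV s] by simp
next
  case (Suc n)
  then obtain u f where s: "s = u \<circ> f" "u \<in> words F n" "f \<in> F" by auto
  have "dist (s x) (s y) \<le> c ^ Suc n * dist (f x) (f y)"
    using Suc.IH s by simp
  also have "\<dots> \<le> c ^ Suc n * (c * dist x y)"
    using c lipschitz_onD[OF lipschitz[OF s(3)]] by (intro mult_left_mono) auto
  finally show ?case by (simp add: mult_ac)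
qed

lemma semigroup_image: "s \<in> ifs_semigroup F \<Longrightarrow> s ` A \<subseteq> A"
proof (induction rule: ifs_semigroup.induct)
  case (generator f)
  then show ?case using invariant by blast
qed auto

text \<open>Splits the image of \<open>A\<close> at a vertex into its images at the out-neighbours
  of that vertex; this is what lets a walk follow a prescribed point.\<close>

lemma image_split: "s ` A = (\<Union>f\<in>F. (s \<circ> f) ` A)"
proof -
  have "s ` A = s ` (\<Union>f\<in>F. f ` A)" using invariant by simp
  then show ?thesis by (simp add: image_UN image_comp)
qed

text \<open>The diameter of \<open>A\<close> is finite and a word with index \<open>n\<close>
  shrinks it by \<open>c ^ Suc n\<close>; the bound is uniform over all words of the same
  length.\<close>

lemma eventually_small:
  assumes "0 < \<delta>"
  obtains N where "\<And>n s x y. \<lbrakk>N \<le> n; s \<in> words F n; x \<in> A; y \<in> A\<rbrakk> \<Longrightarrow> dist (s x) (s y) < \<delta>"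
proof -
  obtain b where b: "0 < b" "\<And>x y. \<lbrakk>x \<in> A; y \<in> A\<rbrakk> \<Longrightarrow> dist x y \<le> b"
    using compact_imp_bounded[OF compact] unfolding bounded_two_points
    by (metis less_eq_real_def linorder_le_less_linear order_trans zero_less_one)
  obtain N where N: "c ^ N < \<delta> / b"
    using real_arch_pow_inv[of "\<delta> / b" c] assms b(1) c(2) by auto
  show thesis
  proof
    fix n s x y assume *: "N \<le> n" "s \<in> words F n" "x \<in> A" "y \<in> A"
    have "dist (s x) (s y) \<le> c ^ Suc n * dist x y"
      by (rule words_lipschitz[OF *(2)])
    also have "\<dots> \<le> c ^ N * b"
      using * b c by (intro mult_mono power_decreasing) auto
    also have "\<dots> < \<delta>"
      using N b(1) by (simp add: field_simps)
    finally show "dist (s x) (s y) < \<delta>" .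
  qed
qed

text \<open>Such a map has Lipschitz constant \<open>c ^ Suc n\<close> for arbitrarily large
  \<open>n\<close>. The bounds hold on the whole space, hence so does constancy.\<close>

lemma constant_if_frequent:
  assumes "infinite {n. s \<in> words F n}"
  shows "s constant_on UNIV"
proof -
  have "s x = s y" for x y
  proof (rule ccontr)
    assume "s x \<noteq> s y"
    then have pos: "0 < dist (s x) (s y)" "0 < dist x y" by auto
    obtain N where N: "c ^ N < dist (s x) (s y) / dist x y"
      using real_arch_pow_inv[of "dist (s x) (s y) / dist x y" c] pos c by auto
    obtain n where n: "N \<le> n" "s \<in> words F n"
      using assms by (auto simp: infinite_nat_iff_unbounded_le)
    have "dist (s x) (s y) \<le> c ^ Suc n * dist x y"
      by (rule words_lipschitz[OF n(2)])
    also have "\<dots> \<le> c ^ N * dist x y"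
      using n c by (intro mult_right_mono power_decreasing) auto
    finally show False
      using N pos by (simp add: field_simps)
  qed
  then show ?thesis by (auto simp: constant_on_def)
qed

section \<open>Construction of rays\<close>

text \<open>A vertex visited infinitely often would be a product of infinitely many different
  lengths, hence constant, which \<open>P\<close> excludes. So loop erasure applies, and it keeps
  \<open>P\<close> because it only selects vertices of the walk.\<close>

lemma ray_exists:
  assumes "\<exists>f\<in>F. P f" and "\<And>s. s \<in> ifs_semigroup F \<Longrightarrow> P s \<Longrightarrow> \<exists>f\<in>F. P (s \<circ> f)"
    and nonconst: "\<And>s. s \<in> ifs_semigroup F \<Longrightarrow> P s \<Longrightarrow> \<not> s constant_on UNIV"
  obtains w where "w \<in> rays F" "\<And>n. P (w n)"
proof -
  obtain w where w: "is_walk F w" "\<And>n. P (w n)"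
    using walk_exists[OF assms(1,2)] by blast
  have "finite {m. w m = w n}" for n
  proof (rule ccontr)
    assume "infinite {m. w m = w n}"
    moreover have "{m. w m = w n} \<subseteq> {m. w n \<in> words F m}"
      using walk_in_words[OF w(1)] by (metis (mono_tags, lifting) Collect_mono)
    ultimately have "w n constant_on UNIV"
      using constant_if_frequent infinite_super by blast
    then show False
      using nonconst w walk_in_semigroup by blast
  qed
  then obtain \<tau> where "w \<circ> \<tau> \<in> rays F"
    using walk_subsequence_ray[OF w(1)] by blast
  then show thesis using that[of "w \<circ> \<tau>"] w(2) by simp
qed

text \<open>A limit point of a finite union is a limit point of one of its members, so the property
  passes to some out-neighbour. It excludes constant maps, whose images are finite, and as the
  images are closed it implies membership.\<close>

lemma ray_through_limit_point:
  assumes "p islimpt A"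
  obtains w where "w \<in> rays F" "\<And>n. p \<in> w n ` A"
proof -
  have closed: "closed (s ` A)" if s: "s \<in> ifs_semigroup F" for s
  proof -
    obtain n where "s \<in> words F n"
      using s unfolding ifs_semigroup_eq by blast
    then have "(c ^ Suc n)-lipschitz_on A s"
      using words_lipschitz c by (intro lipschitz_onI) auto
    then show ?thesis
      using compact_continuous_image[OF lipschitz_on_continuous_on compact] compact_imp_closed by blast
  qed
  obtain w where w: "w \<in> rays F" "\<And>n. p islimpt w n ` A"
  proof (rule ray_exists[of "\<lambda>s. p islimpt s ` A"])
    show "\<exists>f\<in>F. p islimpt f ` A"
      using assms islimpt_finite_union_iff[OF finite, of p "\<lambda>f. f ` A"] invariant by simp
    show "\<exists>f\<in>F. p islimpt (s \<circ> f) ` A" if "p islimpt s ` A" for s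
      using that unfolding image_split[of s] islimpt_finite_union_iff[OF finite] .
    show "\<not> s constant_on UNIV" if "p islimpt s ` A" for s
    proof
      assume "s constant_on UNIV"
      then have "finite (s ` A)"
        by (auto simp: constant_on_def image_constant_conv)
      then show False using that islimpt_finite by blast
    qed
  qed (use that in blast)
  then show thesis
    using that closed closed_limpt walk_in_semigroup unfolding rays_def by (metis mem_Collect_eq)
qed

text \<open>An argument in the manner of Koenig's lemma: the walk keeps the set of products
  \<open>s \<circ> t\<close> infinite. It supplies a ray for a one-point attractor, which has no
  limit point.\<close>

lemma ray_if_infinite_semigroup:
  assumes "infinite (ifs_semigroup F)"
  shows "rays F \<noteq> {}"
proof -
  have split: "(\<circ>) s ` ifs_semigroup F \<subseteq> (\<lambda>f. s \<circ> f) ` F \<union> (\<Union>f\<in>F. (\<circ>) (s \<circ> f) ` ifs_semigroup F)" for s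
  proof clarify
    fix t assume t: "t \<in> ifs_semigroup F" and no: "s \<circ> t \<notin> (\<Union>f\<in>F. (\<circ>) (s \<circ> f) ` ifs_semigroup F)"
    \<comment> \<open>Every product is a single generator or splits off its leftmost one.\<close>
    have "t \<in> F \<or> (\<exists>f\<in>F. \<exists>u\<in>ifs_semigroup F. t = f \<circ> u)"
      using t
    proof induction
      case (comp t u)
      then show ?case by (metis comp_assoc ifs_semigroup.comp)
    qed auto
    then show "s \<circ> t \<in> (\<lambda>f. s \<circ> f) ` F"
      using no by (auto simp: comp_assoc)
  qed
  have step: "\<exists>f\<in>F. infinite ((\<circ>) (s \<circ> f) ` ifs_semigroup F)" if "infinite ((\<circ>) s ` ifs_semigroup F)" for s
  proof (rule ccontr)
    assume "\<not> ?thesis"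
    then have "finite ((\<lambda>f. s \<circ> f) ` F \<union> (\<Union>f\<in>F. (\<circ>) (s \<circ> f) ` ifs_semigroup F))"
      using finite by auto
    with that split show False using finite_subset by blast
  qed
  obtain w where "w \<in> rays F"
  proof (rule ray_exists[of "\<lambda>s. infinite ((\<circ>) s ` ifs_semigroup F)"])
    show "\<exists>f\<in>F. infinite ((\<circ>) f ` ifs_semigroup F)"
      \<comment> \<open>With \<open>s = id\<close> the set of products is the whole semigroup, so
        the step also gives the start.\<close>
      using step[of id] assms by simp
    show "\<not> s constant_on UNIV" if inf: "infinite ((\<circ>) s ` ifs_semigroup F)" for s
    proof
      assume "s constant_on UNIV"
      then obtain a where "\<And>x. s x = a" by (auto simp: constant_on_def)
      then have "(\<circ>) s ` ifs_semigroup F \<subseteq> {\<lambda>_. a}" by auto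
      then show False using inf finite_subset by blast
    qed
  qed (use step in auto)
  then show ?thesis by blast
qed

section \<open>Equivalent rays and connected components\<close>

text \<open>Outside a finite set of vertices the images \<open>s ` A\<close> are too small to meet both sides of a
  separation of \<open>A\<close>, and along an edge these images are nested; so each path component stays
  on one side.\<close>

lemma ray_equiv_imp_connected_component:
  assumes vw: "(v, w) \<in> ray_equiv F" and p: "\<And>n. p \<in> v n ` A" and q: "\<And>n. q \<in> w n ` A"
  shows "connected_component A p q"
proof -
  have walks: "is_walk F v" "is_walk F w"
    using vw by (auto simp: ray_equiv_def rays_def)
  have pq: "p \<in> A" "q \<in> A"
    using p[of 0] q[of 0] walks[THEN walk_in_semigroup, THEN semigroup_image] by blast+
  \<comment> \<open>It suffices that no clopen \<open>T\<close> separates \<open>p\<close> from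
    \<open>q\<close>.\<close>
  have "p \<in> T \<longleftrightarrow> q \<in> T" if T: "closedin (top_of_set A) T" "openin (top_of_set A) T" for T
  proof -
    have "T \<subseteq> A" using T closedin_imp_subset by blast
    have "compact T"
      using T(1) compact closedin_compact by blast
    moreover have "closedin (top_of_set A) (A - T)"
      using T(2) by (simp add: closedin_diff)
    then have "compact (A - T)"
      using closedin_compact[OF compact] by blast
    ultimately obtain \<delta> where \<delta>: "\<delta> > 0" "\<And>x y. \<lbrakk>x \<in> T; y \<in> A - T\<rbrakk> \<Longrightarrow> \<delta> \<le> dist x y"
      using separate_compact_compact[of T "A - T"] by blast
    obtain N where N: "\<And>n s x y. \<lbrakk>N \<le> n; s \<in> words F n; x \<in> A; y \<in> A\<rbrakk> \<Longrightarrow> dist (s x) (s y) < \<delta>"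
      using eventually_small[OF \<delta>(1)] by blast
    \<comment> \<open>\<open>E\<close> collects the products of at most \<open>N\<close> generators;
      a vertex outside it must be a word with index at least \<open>N\<close>, so its image of
      \<open>A\<close> has diameter below the gap \<open>\<delta>\<close>.\<close>
    define E where "E = (\<Union>n<N. words F n)"
    have "finite E" "E \<subseteq> ifs_semigroup F"
      using finite_words[OF finite] words_subset by (auto simp: E_def)
    have side: "s x \<in> T \<longleftrightarrow> s y \<in> T" if "s \<in> ifs_semigroup F - E" "x \<in> A" "y \<in> A" for s x y
    proof -
      obtain n where n: "s \<in> words F n" "N \<le> n"
        using \<open>s \<in> ifs_semigroup F - E\<close> unfolding E_def ifs_semigroup_eq
        by (metis DiffE UN_E UN_I lessThan_iff not_less)
      have "s x \<in> A" "s y \<in> A"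
        using that semigroup_image by blast+
      then show ?thesis
        using N[OF n(2,1) that(2,3)] N[OF n(2,1) that(3,2)] \<delta>(2)[of "s x" "s y"] \<delta>(2)[of "s y" "s x"]
        by force
    qed
    \<comment> \<open>The side of a vertex \<open>s\<close> is read off at one base point; across an
      edge, \<open>(s \<circ> f) a\<close> is the value of \<open>s\<close> at another point of
      \<open>A\<close>.\<close>
    obtain a where a: "a \<in> A" using nonempty by blast
    have edge: "s a \<in> T \<longleftrightarrow> t a \<in> T"
      if "(s, t) \<in> cayley_edges F" "s \<in> ifs_semigroup F - E" for s t
    proof -
      obtain f where "t = s \<circ> f" "f \<in> F"
        using \<open>(s, t) \<in> cayley_edges F\<close> by (auto simp: cayley_edges_def)
      moreover have "f a \<in> A"
        using \<open>f \<in> F\<close> a semigroup_image[OF ifs_semigroup.generator] by blast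
      ultimately show ?thesis
        using side[OF that(2) a] by simp
    qed
    have path: "s a \<in> T \<longleftrightarrow> t a \<in> T" if "(s, t) \<in> connected_avoiding F E" for s t
    proof -
      have "(s, t) \<in> ((cayley_edges F \<union> (cayley_edges F)\<inverse>)
          \<inter> (ifs_semigroup F - E) \<times> (ifs_semigroup F - E))\<^sup>*"
        using that by (simp add: connected_avoiding_def Let_def)
      then show ?thesis
        by induction (use edge in blast)+
    qed
    obtain \<phi> \<psi> :: "nat \<Rightarrow> nat" and C
      where C: "C \<in> path_components F E" "range (v \<circ> \<phi>) \<union> range (w \<circ> \<psi>) \<subseteq> C"
      using vw \<open>finite E\<close> \<open>E \<subseteq> ifs_semigroup F\<close> unfolding ray_equiv_def by blast
    then obtain s where s: "C = connected_avoiding F E `` {s}"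
      by (auto simp: path_components_def elim: quotientE)
    then have "(s, v (\<phi> 0)) \<in> connected_avoiding F E" "(s, w (\<psi> 0)) \<in> connected_avoiding F E"
      using C(2) by auto
    moreover from this have "v (\<phi> 0) \<in> ifs_semigroup F - E" "w (\<psi> 0) \<in> ifs_semigroup F - E"
      by (auto simp: connected_avoiding_def Let_def)
    \<comment> \<open>Since \<open>p\<close> is a value of \<open>v (\<phi> 0)\<close> on
      \<open>A\<close>, it lies on the side of that vertex, and likewise \<open>q\<close>.\<close>
    moreover obtain x y where "x \<in> A" "p = v (\<phi> 0) x" "y \<in> A" "q = w (\<psi> 0) y"
      using p q by blast
    ultimately show ?thesis
      using path side a by metis
  qed
  then show ?thesis
    unfolding connected_component_iff_quasi_component[OF compact] quasi_component_of_def
    using pq by auto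
qed

text \<open>Each component is assigned the end of a ray whose images of \<open>A\<close> all contain
  one of its points; equal ends force the chosen points into one component. In the excluded case
  there is one nondegenerate component but no ray.\<close>

lemma nondegenerate_components_lepoll_ends:
  assumes "\<not> (is_singleton A \<and> finite (ifs_semigroup F))"
  shows "nondegenerate_components A \<lesssim> ends F"
proof -
  have "\<exists>w p. w \<in> rays F \<and> p \<in> C \<and> (\<forall>n. p \<in> w n ` A)" if C: "C \<in> nondegenerate_components A" for C
  proof -
    obtain p where p: "p \<in> A" "C = connected_component_set A p"
      using C by (auto simp: nondegenerate_components_def components_def)
    then have "p \<in> C" by simp
    show ?thesis
    proof (cases "is_singleton A")
      case True
      then have A: "A = {p}" using p(1) by (auto simp: is_singleton_def)
      obtain w where w: "w \<in> rays F"
        \<comment> \<open>Any ray will do here, as every vertex fixes the only point of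
          \<open>A\<close>.\<close>
        using assms True ray_if_infinite_semigroup by blast
      have "p \<in> w n ` A" for n
      proof -
        have "w n \<in> ifs_semigroup F"
          using w walk_in_semigroup by (auto simp: rays_def)
        from semigroup_image[OF this] show ?thesis by (simp add: A)
      qed
      with w \<open>p \<in> C\<close> show ?thesis by metis
    next
      case False
      \<comment> \<open>Otherwise \<open>p\<close> is isolated and, since a connected set with more
        than one point has no isolated points, \<open>C\<close> is the degenerate component of
        \<open>p\<close>.\<close>
      have "p islimpt A"
      proof (rule ccontr)
        assume "\<not> p islimpt A"
        then have "p isolated_in A"
          using p(1) by (simp add: isolated_in_islimpt_iff)
        then have "p \<in> isolated_points A"
          using False by (auto simp: isolated_points_def is_singleton_def)
        moreover have "C = {p}"
        proof -
          have "\<not> p islimpt C"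
            using \<open>\<not> p islimpt A\<close> p(2) connected_component_subset islimpt_subset by metis
          moreover have "connected C" using p(2) by simp
          ultimately show ?thesis
            using connected_imp_perfect \<open>p \<in> C\<close> by blast
        qed
        ultimately show False
          using C by (auto simp: nondegenerate_components_def)
      qed
      then show ?thesis
        using ray_through_limit_point \<open>p \<in> C\<close> by metis
    qed
  qed
  then obtain w p where wp: "\<And>C. C \<in> nondegenerate_components A \<Longrightarrow>
      w C \<in> rays F \<and> p C \<in> C \<and> (\<forall>n. p C \<in> w C n ` A)"
    by metis
  have comp: "C = connected_component_set A (p C)" if C: "C \<in> nondegenerate_components A" for C
  proof -
    obtain x where x: "C = connected_component_set A x"
      using C by (auto simp: nondegenerate_components_def components_def)
    then show ?thesis
      using wp[OF C] connected_component_eq by (metis)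
  qed
  have "inj_on (\<lambda>C. ray_equiv F `` {w C}) (nondegenerate_components A)"
  proof (rule inj_onI)
    fix C D assume CD: "C \<in> nondegenerate_components A" "D \<in> nondegenerate_components A"
      and "ray_equiv F `` {w C} = ray_equiv F `` {w D}"
    then have "(w C, w D) \<in> ray_equiv F"
      using wp ray_equiv_if_same_class by blast
    then have "connected_component A (p C) (p D)"
      using ray_equiv_imp_connected_component wp CD by blast
    then show "C = D"
      using comp[OF CD(1)] comp[OF CD(2)] connected_component_eq by (metis mem_Collect_eq)
  qed
  moreover have "(\<lambda>C. ray_equiv F `` {w C}) ` nondegenerate_components A \<subseteq> ends F"
    using wp ends_class_mem by blast
  ultimately show ?thesis
    unfolding lepoll_def by blast
qed

section \<open>Isolated points\<close>

lemma image_containing_walk: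
  assumes "p \<in> A"
  obtains w where "is_walk F w" "\<And>n. p \<in> w n ` A"
proof (rule walk_exists[of F "\<lambda>s. p \<in> s ` A"])
  show "\<exists>f\<in>F. p \<in> f ` A" using assms invariant by blast
  show "\<exists>f\<in>F. p \<in> (s \<circ> f) ` A" if "p \<in> s ` A" for s
    using that image_split[of s] by blast
qed (use that in blast)

text \<open>Along a walk whose images of \<open>A\<close> contain \<open>p\<close>, these images
  eventually have diameter below the isolation radius of \<open>p\<close> and collapse to
  it.\<close>

lemma isolated_point_image:
  assumes "p \<in> isolated_points A"
  obtains U where "U \<in> ifs_semigroup F" "U ` A = {p}"
proof -
  have "p isolated_in A"
    using assms by (simp add: isolated_points_def)
  then obtain \<delta> where \<delta>: "p \<in> A" "\<delta> > 0" "\<And>y. \<lbrakk>y \<in> A; dist p y < \<delta>\<rbrakk> \<Longrightarrow> y = p"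
    unfolding isolated_in_dist_Ex_iff by blast
  obtain w where w: "is_walk F w" "\<And>n. p \<in> w n ` A"
    using image_containing_walk[OF \<delta>(1)] by blast
  obtain N where N: "\<And>n s x y. \<lbrakk>N \<le> n; s \<in> words F n; x \<in> A; y \<in> A\<rbrakk> \<Longrightarrow> dist (s x) (s y) < \<delta>"
    using eventually_small[OF \<delta>(2)] by blast
  have "y = p" if "y \<in> w N ` A" for y
    using that w(2)[of N] N[OF order_refl walk_in_words[OF w(1)]] \<delta>(3)
      semigroup_image[OF walk_in_semigroup[OF w(1)]] by blast
  then have "w N ` A = {p}" using w(2)[of N] by blast
  with walk_in_semigroup[OF w(1)] show thesis by (rule that)
qed

text \<open>The semigroup is a countable union of finite sets of words, and each isolated point is
  recovered from a map that sends \<open>A\<close> to it.\<close>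

lemma countable_isolated_points: "countable (isolated_points A)"
proof -
  have "countable (ifs_semigroup F)"
    unfolding ifs_semigroup_eq using finite_words[OF finite] by (simp add: countable_finite)
  moreover have "isolated_points A \<subseteq> (\<lambda>U. the_elem (U ` A)) ` ifs_semigroup F"
  proof
    fix p assume "p \<in> isolated_points A"
    then obtain U where "U \<in> ifs_semigroup F" "U ` A = {p}"
      using isolated_point_image by blast
    then show "p \<in> (\<lambda>U. the_elem (U ` A)) ` ifs_semigroup F"
      by (intro image_eqI[of _ _ U]) auto
  qed
  ultimately show ?thesis
    using countable_subset by blast
qed

section \<open>One end and no idempotents\<close>

lemma connected_if_one_end:
  assumes "card (ends F) = 1" and no_idempotent: "\<not> (\<exists>U\<in>ifs_semigroup F. idempotent U)"
  shows "connected A"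
proof -
  have ray: "\<exists>w\<in>rays F. \<forall>n. p \<in> w n ` A" if "p \<in> A" for p
  proof (rule ray_exists[of "\<lambda>s. p \<in> s ` A"])
    show "\<exists>f\<in>F. p \<in> f ` A" using that invariant by blast
    show "\<exists>f\<in>F. p \<in> (s \<circ> f) ` A" if "p \<in> s ` A" for s
      using that image_split[of s] by blast
    show "\<not> s constant_on UNIV" if "s \<in> ifs_semigroup F" for s
    proof
      assume "s constant_on UNIV"
      then have "idempotent s" by (auto simp: constant_on_def idempotent_def)
      then show False using that no_idempotent by blast
    qed
  qed blast
  have "connected_component A p q" if pq: "p \<in> A" "q \<in> A" for p q
  proof -
    obtain v w where vw: "v \<in> rays F" "w \<in> rays F" "\<And>n. p \<in> v n ` A" "\<And>n. q \<in> w n ` A"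
      using ray pq by metis
    \<comment> \<open>The classes of both rays are ends, and there is only one end.\<close>
    then have "ray_equiv F `` {v} = ray_equiv F `` {w}"
      using assms(1) ends_class_mem by (metis card_1_singletonE singletonD)
    then show ?thesis
      using vw ray_equiv_if_same_class ray_equiv_imp_connected_component by metis
  qed
  then show ?thesis by (simp add: connected_iff_connected_component)
qed

end

section \<open>The three claims together\<close>

text \<open>The form reflects two boundary cases. \<open>constant_ifs_example\<close> has no ends,
  whence the guard on the first claim. In \<open>isolated_without_idempotent_example\<close> maps
  are constant on \<open>A\<close> only, so idempotency is claimed on \<open>A\<close> in general
  and globally when constancy on \<open>A\<close> extends to the whole space.\<close>

theorem theorem3:
  fixes F :: "('a::complete_space \<Rightarrow> 'a) set" and A :: "'a set"
  assumes "is_ifs F" and "is_attractor F A"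
  shows
    "(\<not> (is_singleton A \<and> finite (ifs_semigroup F)) \<longrightarrow>
        nondegenerate_components A \<lesssim> ends F) \<and>
     (countable (isolated_points A) \<and>
      (\<forall>p\<in>isolated_points A. \<exists>U\<in>ifs_semigroup F.
        (\<forall>x\<in>A. U (U x) = U x) \<and> U ` A = {p}) \<and>
      ((\<forall>U\<in>ifs_semigroup F. U constant_on A \<longrightarrow> U constant_on UNIV) \<longrightarrow>
        (\<forall>p\<in>isolated_points A. \<exists>U\<in>ifs_semigroup F. idempotent U \<and> range U = {p}))) \<and>
     (card (ends F) = 1 \<and> \<not> (\<exists>U\<in>ifs_semigroup F. idempotent U) \<longrightarrow> connected A)"
proof -
  have F: "finite F" "F \<noteq> {}" "\<forall>f\<in>F. \<exists>c<1. c-lipschitz_on UNIV f"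
    using assms(1) by (auto simp: is_ifs_def contraction_def)
  then obtain k where k: "\<And>f. f \<in> F \<Longrightarrow> k f < 1 \<and> (k f)-lipschitz_on UNIV f"
    by metis
  \<comment> \<open>The maximum stays below 1 because \<open>F\<close> is finite and
    nonempty.\<close>
  define c where "c = Max (k ` F)"
  have le: "k f \<le> c" if "f \<in> F" for f
    using that F(1) by (simp add: c_def)
  have lip: "c-lipschitz_on UNIV f" if "f \<in> F" for f
    using k[OF that] le[OF that] lipschitz_on_le by blast
  have "c < 1"
    using F k by (simp add: c_def)
  moreover have "0 \<le> c"
    using F(2) lip lipschitz_on_nonneg by blast
  ultimately interpret ifs_attractor F A c
    using F(1) lip assms(2) unfolding is_attractor_def by unfold_locales blast+
  have fixed: "U p = p" if "U ` A = {p}" "p \<in> isolated_points A" for U p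
    using that by (auto simp: isolated_points_def isolated_in_def)
  have "\<exists>U\<in>ifs_semigroup F. (\<forall>x\<in>A. U (U x) = U x) \<and> U ` A = {p}"
    if p: "p \<in> isolated_points A" for p
  proof -
    obtain U where U: "U \<in> ifs_semigroup F" "U ` A = {p}"
      using isolated_point_image[OF p] by blast
    moreover have "U (U x) = U x" if "x \<in> A" for x
    proof -
      have "U x = p" using U(2) that by blast
      then show ?thesis using fixed[OF U(2) p] by simp
    qed
    ultimately show ?thesis by blast
  qed
  moreover have "\<exists>U\<in>ifs_semigroup F. idempotent U \<and> range U = {p}"
    if const: "\<forall>U\<in>ifs_semigroup F. U constant_on A \<longrightarrow> U constant_on UNIV"
      and p: "p \<in> isolated_points A" for p
  proof -
    obtain U where U: "U \<in> ifs_semigroup F" "U ` A = {p}"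
      using isolated_point_image[OF p] by blast
    then have "U constant_on A" by (auto simp: constant_on_def)
    \<comment> \<open>The constant value is \<open>p\<close>, because \<open>U\<close> fixes
      \<open>p\<close>.\<close>
    then have "U = (\<lambda>_. p)"
      using const U(1) fixed[OF U(2) p] by (auto simp: constant_on_def fun_eq_iff)
    with U(1) show ?thesis by (intro bexI[of _ U]) (auto simp: idempotent_def)
  qed
  ultimately show ?thesis
    using nondegenerate_components_lepoll_ends countable_isolated_points connected_if_one_end
    by (intro conjI impI ballI) auto
qed

end
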